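(* Let $X$ be an order continuous Banach lattice. Let $(x_\alpha)$ be a net in $X$ whose set of members is relatively weakly compact, and suppose $(x_\alpha)$ uo-converges to some $x\in X$. Then $x_\alpha$ converges to $x$ in $|\sigma|(X,X^* )$, i.e. $x^*(|x_\alpha-x|)\to 0$ for every $x^*\in X^*_+$.
   Context: A Banach lattice is order continuous if every order null net is norm null. A net $(x_\alpha)$ in a vector lattice $X$ order converges to $x$ (written $x_\alpha\xrightarrow{o}x$) if there is a net $(z_\beta)$ (possibly over a different index set) with $z_\beta\downarrow 0$ such that for every $\beta$ there is $\alpha_0$ with $|x_\alpha-x|\le z_\beta$ for all $\alpha\ge\alpha_0$. The net uo-converges to $x$ (unbounded order converges) if $|x_\alpha-x|\wedge y\xrightarrow{o}0$ for all $y\in X_+$. $X^*$ is the norm dual; $|\sigma|(X,X^* )$ is the absolute weak topology, generated by the seminorms $x\mapsto x^*(|x|)$, $x^*\in X^*_+$. *)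

theory Defs
  imports "HOL-Analysis.Analysis" "HOL-Library.Lattice_Algebras"
begin

class banach_lattice = banach + ordered_real_vector + lattice_ab_group_add_abs +
  assumes norm_mono: "\<bar>x\<bar> \<le> \<bar>y\<bar> \<Longrightarrow> norm x \<le> norm y"

(* A net is a function on a nonempty set I that is directed by a preorder le;
   "le a b" is read as "b \<ge> a". *)

definition directed_set :: "'i set \<Rightarrow> ('i \<Rightarrow> 'i \<Rightarrow> bool) \<Rightarrow> bool" where
  "directed_set I le \<longleftrightarrow>
     I \<noteq> {} \<and>
     (\<forall>a\<in>I. le a a) \<and>
     (\<forall>a\<in>I. \<forall>b\<in>I. \<forall>c\<in>I. le a b \<longrightarrow> le b c \<longrightarrow> le a c) \<and>
     (\<forall>a\<in>I. \<forall>b\<in>I. \<exists>c\<in>I. le a c \<and> le b c)"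

definition net_filter :: "'i set \<Rightarrow> ('i \<Rightarrow> 'i \<Rightarrow> bool) \<Rightarrow> 'i filter" where
  "net_filter I le = (INF a\<in>I. principal {b\<in>I. le a b})"

lemma eventually_net_filter:
  assumes "directed_set I le"
  shows "eventually P (net_filter I le) \<longleftrightarrow> (\<exists>a\<in>I. \<forall>b\<in>I. le a b \<longrightarrow> P b)"
proof -
  have "eventually P (net_filter I le) \<longleftrightarrow> (\<exists>a\<in>I. eventually P (principal {b\<in>I. le a b}))"
    unfolding net_filter_def
  proof (rule eventually_INF_base)
    show "I \<noteq> {}"
      using assms by (simp add: directed_set_def)
    fix a b assume ab: "a \<in> I" "b \<in> I"
    then obtain c where c: "c \<in> I" "le a c" "le b c"
      using assms unfolding directed_set_def by blast
    have "{d\<in>I. le c d} \<subseteq> {d\<in>I. le a d} \<inter> {d\<in>I. le b d}"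
      using assms ab c unfolding directed_set_def by blast
    then show "\<exists>c\<in>I. principal {d\<in>I. le c d} \<le> inf (principal {d\<in>I. le a d}) (principal {d\<in>I. le b d})"
      using c(1) by auto
  qed
  then show ?thesis
    by (auto simp: eventually_principal)
qed

definition (in banach_lattice) decreasing_to_zero ::
  "'j set \<Rightarrow> ('j \<Rightarrow> 'j \<Rightarrow> bool) \<Rightarrow> ('j \<Rightarrow> 'a) \<Rightarrow> bool" where
  "decreasing_to_zero J le z \<longleftrightarrow>
     (\<forall>a\<in>J. \<forall>b\<in>J. le a b \<longrightarrow> z b \<le> z a) \<and>
     (\<forall>b\<in>J. 0 \<le> z b) \<and> (\<forall>w. (\<forall>b\<in>J. w \<le> z b) \<longrightarrow> w \<le> 0)"

(* HOL cannot quantify existentially over the type of the second index set. Index sets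
   contained in the space itself suffice, because a decreasing net can be re-indexed by its
   range; lemma order_convergesI covers dominating nets over an arbitrary index type. *)

definition (in banach_lattice) order_converges ::
  "'i set \<Rightarrow> ('i \<Rightarrow> 'i \<Rightarrow> bool) \<Rightarrow> ('i \<Rightarrow> 'a) \<Rightarrow> 'a \<Rightarrow> bool" where
  "order_converges I le x l \<longleftrightarrow>
     (\<exists>(J :: 'a set) leJ z. directed_set J leJ \<and> decreasing_to_zero J leJ z \<and>
        (\<forall>b\<in>J. \<exists>a0\<in>I. \<forall>a\<in>I. le a0 a \<longrightarrow> \<bar>x a - l\<bar> \<le> z b))"

lemma order_convergesI:
  fixes x :: "'i \<Rightarrow> 'a::banach_lattice" and z :: "'j \<Rightarrow> 'a"
  assumes dir: "directed_set J leJ" and dec: "decreasing_to_zero J leJ z"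
    and dom: "\<And>b. b \<in> J \<Longrightarrow> \<exists>a0\<in>I. \<forall>a\<in>I. le a0 a \<longrightarrow> \<bar>x a - l\<bar> \<le> z b"
  shows "order_converges I le x l"
  unfolding order_converges_def
proof (intro exI conjI)
  show "directed_set (z ` J) (\<lambda>u v. v \<le> u)"
    unfolding directed_set_def
  proof (intro conjI)
    show "z ` J \<noteq> {}"
      using dir by (simp add: directed_set_def)
    show "\<forall>u\<in>z ` J. \<forall>v\<in>z ` J. \<exists>w\<in>z ` J. w \<le> u \<and> w \<le> v"
    proof (intro ballI)
      fix u v assume "u \<in> z ` J" "v \<in> z ` J"
      then obtain a b where ab: "a \<in> J" "b \<in> J" "u = z a" "v = z b" by blast
      then obtain c where "c \<in> J" "leJ a c" "leJ b c"
        using dir unfolding directed_set_def by blast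
      then show "\<exists>w\<in>z ` J. w \<le> u \<and> w \<le> v"
        using dec ab unfolding decreasing_to_zero_def by blast
    qed
  qed auto
  show "decreasing_to_zero (z ` J) (\<lambda>u v. v \<le> u) (\<lambda>u. u)"
    using dec by (auto simp: decreasing_to_zero_def)
  show "\<forall>b\<in>z ` J. \<exists>a0\<in>I. \<forall>a\<in>I. le a0 a \<longrightarrow> \<bar>x a - l\<bar> \<le> b"
    using dom by blast
qed

definition uo_converges ::
  "'i set \<Rightarrow> ('i \<Rightarrow> 'i \<Rightarrow> bool) \<Rightarrow> ('i \<Rightarrow> 'a::banach_lattice) \<Rightarrow> 'a \<Rightarrow> bool" where
  "uo_converges I le x l \<longleftrightarrow>
     (\<forall>y\<ge>0. order_converges I le (\<lambda>a. inf \<bar>x a - l\<bar> y) 0)"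

(* The axiom speaks about nets indexed by subsets of the space only; lemma
   order_null_imp_norm_null extends it to nets over an arbitrary index type. *)

class order_continuous_banach_lattice = banach_lattice +
  assumes order_null_imp_norm_null_self:
    "directed_set (I :: 'a set) le \<Longrightarrow> order_converges I le (x :: 'a \<Rightarrow> 'a) 0 \<Longrightarrow>
      (x \<longlongrightarrow> 0) (net_filter I le)"

lemma order_null_imp_norm_null:
  fixes x :: "'i \<Rightarrow> 'a::order_continuous_banach_lattice"
  assumes dir: "directed_set I le" and null: "order_converges I le x 0"
  shows "(x \<longlongrightarrow> 0) (net_filter I le)"
proof (rule ccontr)
  assume "\<not> (x \<longlongrightarrow> 0) (net_filter I le)"
  then obtain e where e: "e > 0"
    and large: "\<And>a. a \<in> I \<Longrightarrow> \<exists>b\<in>I. le a b \<and> norm (x b) \<ge> e"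
    unfolding tendsto_iff eventually_net_filter[OF dir] by (auto simp: not_less)
  obtain J :: "'a set" and leJ z where J: "directed_set J leJ" "decreasing_to_zero J leJ z"
    and dom: "\<And>b. b \<in> J \<Longrightarrow> \<exists>a0\<in>I. \<forall>a\<in>I. le a0 a \<longrightarrow> \<bar>x a - 0\<bar> \<le> z b"
    using null unfolding order_converges_def by blast
  have "\<forall>b\<in>J. \<exists>a\<in>I. \<bar>x a\<bar> \<le> z b \<and> norm (x a) \<ge> e"
    using dom large by fastforce
  then obtain a where a: "\<And>b. b \<in> J \<Longrightarrow> \<bar>x (a b)\<bar> \<le> z b \<and> norm (x (a b)) \<ge> e"
    by metis
  have "order_converges J leJ (\<lambda>b. x (a b)) 0"
  proof (rule order_convergesI[OF J])
    fix b assume b: "b \<in> J"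
    have "\<bar>x (a c) - 0\<bar> \<le> z b" if "c \<in> J" "leJ b c" for c
    proof -
      have "z c \<le> z b"
        using J(2) b that unfolding decreasing_to_zero_def by blast
      then show ?thesis
        using a[OF that(1)] by (auto intro: order_trans)
    qed
    then show "\<exists>a0\<in>J. \<forall>c\<in>J. leJ a0 c \<longrightarrow> \<bar>x (a c) - 0\<bar> \<le> z b"
      using b by blast
  qed
  then have "((\<lambda>b. x (a b)) \<longlongrightarrow> 0) (net_filter J leJ)"
    by (rule order_null_imp_norm_null_self[OF J(1)])
  then obtain b where "b \<in> J" "\<forall>c\<in>J. leJ b c \<longrightarrow> norm (x (a c)) < e"
    using e unfolding tendsto_iff eventually_net_filter[OF J(1)] by auto
  moreover have "leJ b b"
    using J(1) \<open>b \<in> J\<close> by (simp add: directed_set_def)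
  ultimately show False
    using a[of b] by auto
qed

definition weak_topology :: "'a::real_normed_vector topology" where
  "weak_topology =
     topology_generated_by {blinfun_apply f -` U | (f :: 'a \<Rightarrow>\<^sub>L real) U. open U}"

definition relatively_weakly_compact :: "'a::real_normed_vector set \<Rightarrow> bool" where
  "relatively_weakly_compact A \<longleftrightarrow> compactin weak_topology (weak_topology closure_of A)"

definition positive_functional :: "('a::banach_lattice \<Rightarrow>\<^sub>L real) \<Rightarrow> bool" where
  "positive_functional f \<longleftrightarrow> (\<forall>y\<ge>0. 0 \<le> blinfun_apply f y)"

definition absolute_weak_topology :: "'a::banach_lattice topology" where
  "absolute_weak_topology =
     topology_generated_by
       {{y. blinfun_apply f \<bar>y - c\<bar> < e} | f c e. positive_functional f \<and> e > 0}"

end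

theory Submission
  imports Defs "HOL-Real_Asymp.Real_Asymp"
begin

text \<open>
  Let \<open>f\<close> be a positive functional. The claim reduces to \<open>f \<bar>x\<^sub>a - l\<bar> \<rightarrow> 0\<close>. Suppose that these values
  are frequently at least \<open>e > 0\<close>. Unbounded order convergence and order continuity of the norm give
  \<open>inf \<bar>x\<^sub>a - l\<bar> s \<rightarrow> 0\<close> in norm for every \<open>s \<ge> 0\<close>.
  Hence a sequence can be picked from the net, with values at least \<open>e\<close>, whose pairwise meets are all
  below one element \<open>W\<close> of small norm (\<open>frequently_large_imp_almost_disjoint\<close>).

  Subtracting \<open>W\<close> makes the sequence disjoint (\<open>inf_excess_eq_0\<close>) at the cost of \<open>f W\<close>. A sequence of
  disjoint positive elements splits \<open>f\<close> into functionals \<open>g\<^sub>n\<close>, one for each generated band, with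
  \<open>\<Sum>\<^sub>n \<bar>g\<^sub>n z\<bar> \<le> f \<bar>z\<bar>\<close> for all \<open>z\<close> (\<open>ex_disjoint_band_functionals\<close>). So the \<open>g\<^sub>n\<close> map the space
  boundedly into \<open>\<ell>\<^sup>1\<close>, while \<open>g\<^sub>n\<close> stays away from \<open>0\<close> on the \<open>n\<close>-th member of the sequence. A relatively
  weakly compact set does not allow this, by the Schur property of \<open>\<ell>\<^sup>1\<close>; the part of it that is
  required is proved directly by a gliding hump argument (\<open>diagonal_functionals_tendsto_0\<close>).
\<close>

section \<open>Disjointness in vector lattices\<close>

lemma inf_add_le:
  fixes a b c :: "'a::lattice_ab_group_add"
  assumes "0 \<le> a" "0 \<le> b" "0 \<le> c"
  shows "inf (a + b) c \<le> inf a c + inf b c"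
proof -
  have "inf (a + b) c \<le> a + c" "inf (a + b) c \<le> c + b" "inf (a + b) c \<le> c + c"
    using assms by (auto intro: le_infI2 simp: add_increasing add_increasing2)
  then show ?thesis
    by (simp add: add_inf_distrib_left add_inf_distrib_right)
qed

lemma inf_sum_eq_0:
  fixes w :: "'i \<Rightarrow> 'a::lattice_ab_group_add"
  assumes "finite F" "\<And>i. i \<in> F \<Longrightarrow> 0 \<le> w i" "0 \<le> u" "\<And>i. i \<in> F \<Longrightarrow> inf (w i) u = 0"
  shows "inf (sum w F) u = 0"
  using assms
proof (induction F rule: finite_induct)
  case (insert i F)
  have "inf (w i + sum w F) u \<le> inf (w i) u + inf (sum w F) u"
    by (rule inf_add_le) (use insert in \<open>auto intro: sum_nonneg\<close>)
  also have "\<dots> = 0"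
    using insert by simp
  moreover have "0 \<le> inf (w i + sum w F) u"
    using insert by (auto intro!: add_nonneg_nonneg sum_nonneg)
  ultimately show ?case
    using insert by (simp add: antisym)
qed (simp add: inf_absorb1)

text \<open>Disjoint positive elements have their supremum as sum, so a sum of disjoint positive
  elements obeys every bound that its summands obey.\<close>

lemma sum_disjoint_le:
  fixes w :: "'i \<Rightarrow> 'a::lattice_ab_group_add"
  assumes "finite F" "0 \<le> x" "\<And>i. i \<in> F \<Longrightarrow> 0 \<le> w i" "\<And>i. i \<in> F \<Longrightarrow> w i \<le> x"
    and "\<And>i j. i \<in> F \<Longrightarrow> j \<in> F \<Longrightarrow> i \<noteq> j \<Longrightarrow> inf (w i) (w j) = 0"
  shows "sum w F \<le> x"
  using assms
proof (induction F rule: finite_induct)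
  case (insert i F)
  have "inf (sum w F) (w i) = 0"
    by (rule inf_sum_eq_0) (use insert in auto)
  then have "w i + sum w F = sup (sum w F) (w i)"
    using add_eq_inf_sup[of "sum w F" "w i"] by (simp add: add.commute)
  also have "\<dots> \<le> x"
    using insert by auto
  finally show ?case
    using insert by simp
qed simp

lemma pprt_diff_pprt_uminus: "pprt x - pprt (- x) = (x::'a::lattice_ab_group_add)"
  using prts[of x] pprt_neg[of x] by (metis diff_minus_eq_add)

lemma inf_pprt_pprt_uminus: "inf (pprt x) (pprt (- x)) = (0::'a::lattice_ab_group_add)"
proof -
  have "inf (pprt x) (pprt (- x)) = inf x 0 + pprt (- x)"
    by (subst add_inf_distrib_right)
      (metis add_cancel_left_left diff_add_cancel diff_conv_add_uminus minus_minus pprt_neg prts)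
  also have "\<dots> = 0"
    by (simp add: pprt_neg nprt_def del: neg_inf_eq_sup)
  finally show ?thesis .
qed

text \<open>This is distributivity of the lattice in the only case needed. The meet of the two positive
  parts is disjoint from both negative parts; since \<open>inf u v \<le> 0\<close>, it also lies below their sum,
  and so it is disjoint from itself.\<close>

lemma inf_pprt_pprt_eq_0:
  fixes u v :: "'a::lattice_ab_group_add"
  assumes "inf u v \<le> 0"
  shows "inf (pprt u) (pprt v) = 0"
proof -
  define c where "c = inf (pprt u) (pprt v)"
  define d where "d = pprt (- u) + pprt (- v)"
  have c0: "0 \<le> c" by (simp add: c_def)
  have "inf (pprt (-u)) c \<le> inf (pprt u) (pprt (- u))" "inf (pprt (-v)) c \<le> inf (pprt v) (pprt (- v))"
    by (auto simp: c_def intro: le_infI2)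
  then have z: "inf (pprt (-u)) c \<le> 0" "inf (pprt (-v)) c \<le> 0"
    by (simp_all add: inf_pprt_pprt_uminus)
  have "inf d c \<le> inf (pprt (-u)) c + inf (pprt (-v)) c"
    unfolding d_def by (rule inf_add_le) (simp_all add: c0)
  also have "\<dots> \<le> 0"
    using add_mono[OF z] by simp
  finally have "inf d c \<le> 0" .
  have "u = pprt u - pprt (- u)" "v = pprt v - pprt (- v)"
    by (simp_all only: pprt_diff_pprt_uminus)
  moreover have "c - d \<le> pprt u - pprt (- u)" "c - d \<le> pprt v - pprt (- v)"
    by (rule diff_mono; simp add: c_def d_def)+
  ultimately have "c - d \<le> u" "c - d \<le> v"
    by simp_all
  then have "c - d \<le> inf u v" by simp
  with assms have "c \<le> d" by (meson diff_le_0_iff_le order_trans)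
  then have "inf d c = c" by (simp add: inf_absorb2)
  with \<open>inf d c \<le> 0\<close> c0 show ?thesis
    by (simp add: c_def antisym)
qed

text \<open>The device that makes a sequence disjoint: an element dominating all pairwise meets, once
  subtracted, leaves disjoint positive parts.\<close>

lemma inf_excess_eq_0:
  fixes a b w :: "'a::lattice_ab_group_add"
  assumes "inf a b \<le> w"
  shows "inf (pprt (a - w)) (pprt (b - w)) = 0"
proof (rule inf_pprt_pprt_eq_0)
  have "inf (a - w) (b - w) = inf a b - w"
    using add_inf_distrib_right[of a b "- w"] by simp
  with assms show "inf (a - w) (b - w) \<le> 0" by simp
qed

lemma scaleR_inf:
  fixes x y :: "'a::banach_lattice"
  assumes "0 < c"
  shows "c *\<^sub>R inf x y = inf (c *\<^sub>R x) (c *\<^sub>R y)"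
proof (rule antisym)
  have "(1 / c) *\<^sub>R inf (c *\<^sub>R x) (c *\<^sub>R y) \<le> (1 / c) *\<^sub>R (c *\<^sub>R x)"
       "(1 / c) *\<^sub>R inf (c *\<^sub>R x) (c *\<^sub>R y) \<le> (1 / c) *\<^sub>R (c *\<^sub>R y)"
    using assms by (intro scaleR_left_mono; simp)+
  then have "(1 / c) *\<^sub>R inf (c *\<^sub>R x) (c *\<^sub>R y) \<le> inf x y"
    using assms by simp
  then have "c *\<^sub>R ((1 / c) *\<^sub>R inf (c *\<^sub>R x) (c *\<^sub>R y)) \<le> c *\<^sub>R inf x y"
    using assms by (intro scaleR_left_mono) auto
  then show "inf (c *\<^sub>R x) (c *\<^sub>R y) \<le> c *\<^sub>R inf x y"
    using assms by simp
qed (use assms in \<open>auto intro: scaleR_left_mono\<close>)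

lemma scaleR_pprt:
  fixes x :: "'a::banach_lattice"
  assumes "0 \<le> c"
  shows "pprt (c *\<^sub>R x) = c *\<^sub>R pprt x"
proof (cases "c = 0")
  case False
  with assms have "c *\<^sub>R inf (- x) 0 = inf (c *\<^sub>R (- x)) (c *\<^sub>R 0)"
    by (intro scaleR_inf) auto
  then have "c *\<^sub>R nprt (- x) = nprt (- (c *\<^sub>R x))"
    by (simp add: nprt_def)
  then show ?thesis by (simp add: nprt_neg)
qed simp

lemma disjoint_scaleR:
  fixes u v :: "'a::banach_lattice"
  assumes "0 \<le> t" "0 \<le> u" "0 \<le> v" "inf u v = 0"
  shows "inf u (t *\<^sub>R v) = 0"
proof -
  have "inf u (t *\<^sub>R v) \<le> inf ((1 + t) *\<^sub>R u) ((1 + t) *\<^sub>R v)"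
  proof -
    have "1 *\<^sub>R u \<le> (1 + t) *\<^sub>R u" "t *\<^sub>R v \<le> (1 + t) *\<^sub>R v"
      using assms by (intro scaleR_right_mono; simp)+
    then show ?thesis by (simp add: le_infI1 le_infI2)
  qed
  also have "\<dots> = 0"
    using scaleR_inf[of "1 + t" u v] assms by simp
  finally show ?thesis
    using assms by (simp add: antisym scaleR_nonneg_nonneg)
qed

lemma norm_pprt_le:
  fixes x :: "'a::banach_lattice"
  shows "norm (pprt x) \<le> norm x" "norm (pprt (- x)) \<le> norm x"
proof -
  have *: "norm (pprt y) \<le> norm y" for y :: 'a
    by (rule norm_mono) (simp add: abs_prts[of y])
  show "norm (pprt x) \<le> norm x" "norm (pprt (- x)) \<le> norm x"
    using *[of x] *[of "- x"] by simp_all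
qed

lemma abs_eq_pprt: "\<bar>x\<bar> = pprt x + pprt (- x)" for x :: "'a::banach_lattice"
  by (simp add: abs_prts pprt_neg)

section \<open>Functionals concentrated on a principal band\<close>

text \<open>Every element is a difference of two positive ones, and additivity makes the difference of
  the values independent of the representation; this gives the linear extension.\<close>

lemma cone_functional_extends:
  fixes p :: "'a::banach_lattice \<Rightarrow> real"
  assumes add: "\<And>x y. 0 \<le> x \<Longrightarrow> 0 \<le> y \<Longrightarrow> p (x + y) = p x + p y"
    and scale: "\<And>c x. 0 < c \<Longrightarrow> 0 \<le> x \<Longrightarrow> p (c *\<^sub>R x) = c * p x"
    and bound: "\<And>x. 0 \<le> x \<Longrightarrow> \<bar>p x\<bar> \<le> K * norm x"
  shows "\<exists>g :: 'a \<Rightarrow>\<^sub>L real. \<forall>x\<ge>0. g x = p x"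
proof -
  define q where "q x = p (pprt x) - p (pprt (- x))" for x
  have p0: "p 0 = 0"
    using add[of 0 0] by simp
  have q_diff: "q (a - b) = p a - p b" if "0 \<le> a" "0 \<le> b" for a b
  proof -
    have "pprt (a - b) - pprt (- (a - b)) = a - b"
      by (rule pprt_diff_pprt_uminus)
    then have "pprt (a - b) + b = a + pprt (- (a - b))"
      by (simp add: algebra_simps)
    then have "p (pprt (a - b)) + p b = p a + p (pprt (- (a - b)))"
      using that by (metis add zero_le_pprt)
    then show ?thesis by (simp add: q_def)
  qed
  have split: "x = pprt x - pprt (- x)" for x :: 'a
    by (rule pprt_diff_pprt_uminus[symmetric])
  \<comment> \<open>On the zero space the bound is vacuous and \<open>K\<close> may be negative.\<close>
  have "K \<ge> 0 \<or> (\<forall>x::'a. norm x = 0)"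
  proof (rule disjCI)
    assume "\<not> (\<forall>x::'a. norm x = 0)"
    then obtain x :: 'a where "norm x \<noteq> 0" by blast
    then have "0 < norm \<bar>x\<bar>" by simp
    moreover have "0 \<le> K * norm \<bar>x\<bar>" using bound[of "\<bar>x\<bar>"] by simp
    ultimately show "K \<ge> 0" by (simp add: zero_le_mult_iff)
  qed
  then have Kpos: "K * norm y \<le> \<bar>K\<bar> * norm x" if "norm y \<le> norm x" for x y :: 'a
    using that by (metis abs_of_nonneg mult_left_mono mult_zero_right order_refl)
  have "bounded_linear q"
  proof (rule bounded_linear_intro)
    fix x y :: 'a
    have "x + y = (pprt x + pprt y) - (pprt (- x) + pprt (- y))"
      using split[of x] split[of y] by (metis add_diff_add)
    then show "q (x + y) = q x + q y"
      using q_diff[of "pprt x + pprt y" "pprt (- x) + pprt (- y)"]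
      by (simp add: add q_def)
  next
    fix r and x :: 'a
    show "q (r *\<^sub>R x) = r *\<^sub>R q x"
    proof (cases "r \<ge> 0")
      case True
      then show ?thesis
        using scaleR_pprt[of r x] scaleR_pprt[of r "- x"]
        by (cases "r = 0") (simp_all add: q_def scale p0 algebra_simps)
    next
      case False
      then show ?thesis
        using scaleR_pprt[of "- r" x] scaleR_pprt[of "- r" "- x"]
          scale[of "- r" "pprt x"] scale[of "- r" "pprt (- x)"]
        by (simp add: q_def algebra_simps)
    qed
  next
    fix x :: 'a
    have "\<bar>p (pprt x)\<bar> \<le> \<bar>K\<bar> * norm x" "\<bar>p (pprt (- x))\<bar> \<le> \<bar>K\<bar> * norm x"
      using bound[of "pprt x"] bound[of "pprt (- x)"] Kpos[OF norm_pprt_le(1)[of x]]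
        Kpos[OF norm_pprt_le(2)[of x]] by auto
    then show "norm (q x) \<le> norm x * (2 * \<bar>K\<bar>)"
      by (simp add: q_def algebra_simps)
  qed
  moreover have "q x = p x" if "0 \<le> x" for x
    using q_diff[of x 0] that by (simp add: p0)
  ultimately show ?thesis
    by (metis bounded_linear_Blinfun_apply)
qed

lemma positive_functional_mono:
  assumes "positive_functional f" "x \<le> y"
  shows "blinfun_apply f x \<le> blinfun_apply f y"
  using assms unfolding positive_functional_def
  by (metis blinfun.diff_right diff_ge_0_iff_ge)

text \<open>The functional \<open>g\<close> is \<open>f\<close> restricted to the band generated by \<open>v\<close>: in \<open>L\<^sup>1\<close> it is
  integration over the set where \<open>v > 0\<close>. Truncating by multiples of \<open>v\<close> and passing to the limit
  gives it without constructing a band projection. Truncation at \<open>t\<close> is subadditive and a sum of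
  two truncations at \<open>t\<close> is dominated by one at \<open>2 * t\<close>, so the limit is additive.\<close>

lemma ex_band_functional:
  fixes f :: "'a::banach_lattice \<Rightarrow>\<^sub>L real"
  assumes f: "positive_functional f" and v: "0 \<le> v"
  shows "\<exists>g :: 'a \<Rightarrow>\<^sub>L real. \<forall>x\<ge>0. ((\<lambda>t. f (inf x (t *\<^sub>R v))) \<longlongrightarrow> g x) at_top"
proof -
  define F where "F x t = f (inf x (t *\<^sub>R v))" for x t
  define p where "p x = (SUP t. F x t)" for x
  have F_le: "F x t \<le> f x" for x t
    unfolding F_def by (rule positive_functional_mono[OF f]) simp
  have F_nonneg: "0 \<le> F x t" if "0 \<le> x" "0 \<le> t" for x t
    using f that v by (simp add: F_def positive_functional_def scaleR_nonneg_nonneg)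
  have bdd: "bdd_above (range (F x))" for x
    using F_le by (auto simp: bdd_above_def)
  have lim: "(F x \<longlongrightarrow> p x) at_top" for x
  proof (rule order_tendstoI)
    fix a assume "a < p x"
    then obtain s where s: "a < F x s"
      unfolding p_def using less_cSUP_iff[OF _ bdd] by blast
    have "F x s \<le> F x t" if "s \<le> t" for t
      unfolding F_def using that v
      by (intro positive_functional_mono[OF f]) (simp add: le_infI2 scaleR_right_mono)
    with s show "\<forall>\<^sub>F t in at_top. a < F x t"
      unfolding eventually_at_top_linorder by (meson less_le_trans)
  next
    fix a assume "p x < a"
    moreover have "F x t \<le> p x" for t
      unfolding p_def by (rule cSUP_upper[OF _ bdd]) simp
    ultimately show "\<forall>\<^sub>F t in at_top. F x t < a"
      by (auto intro: always_eventually le_less_trans)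
  qed
  have "\<exists>g :: 'a \<Rightarrow>\<^sub>L real. \<forall>x\<ge>0. g x = p x"
  proof (rule cone_functional_extends)
    fix x y :: 'a assume xy: "0 \<le> x" "0 \<le> y"
    have "p (x + y) \<le> p x + p y"
    proof (rule tendsto_le[OF _ tendsto_add[OF lim lim] lim])
      show "\<forall>\<^sub>F t in at_top. F (x + y) t \<le> F x t + F y t"
        using eventually_ge_at_top[of 0]
      proof eventually_elim
        case (elim t)
        then have "inf (x + y) (t *\<^sub>R v) \<le> inf x (t *\<^sub>R v) + inf y (t *\<^sub>R v)"
          using xy v by (intro inf_add_le) (auto intro: scaleR_nonneg_nonneg)
        from positive_functional_mono[OF f this] show ?case
          by (simp add: F_def blinfun.add_right)
      qed
    qed simp
    moreover have "p x + p y \<le> p (x + y)"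
    proof (rule tendsto_le[OF _ _ tendsto_add[OF lim lim]])
      show "((\<lambda>t. F (x + y) (2 * t)) \<longlongrightarrow> p (x + y)) at_top"
        by (rule filterlim_compose[OF lim])
          (rule filterlim_tendsto_pos_mult_at_top[OF tendsto_const zero_less_numeral filterlim_ident])
      show "\<forall>\<^sub>F t in at_top. F x t + F y t \<le> F (x + y) (2 * t)"
      proof (rule always_eventually, rule allI)
        fix t
        have "inf x (t *\<^sub>R v) + inf y (t *\<^sub>R v) \<le> x + y"
          by (rule add_mono) auto
        moreover have "inf x (t *\<^sub>R v) + inf y (t *\<^sub>R v) \<le> t *\<^sub>R v + t *\<^sub>R v"
          by (rule add_mono) auto
        ultimately have "inf x (t *\<^sub>R v) + inf y (t *\<^sub>R v) \<le> inf (x + y) ((2 * t) *\<^sub>R v)"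
          unfolding mult_2 scaleR_add_left by (rule inf_greatest)
        from positive_functional_mono[OF f this] show "F x t + F y t \<le> F (x + y) (2 * t)"
          by (simp add: F_def blinfun.add_right)
      qed
    qed simp
    ultimately show "p (x + y) = p x + p y" by simp
  next
    fix c :: real and x :: 'a assume c: "0 < c"
    have "F (c *\<^sub>R x) (c * t) = c * F x t" for t
      unfolding F_def using scaleR_inf[OF c, of x "t *\<^sub>R v"]
      by (metis blinfun.scaleR_right real_scaleR_def scaleR_scaleR)
    moreover have "((\<lambda>t. F (c *\<^sub>R x) (c * t)) \<longlongrightarrow> p (c *\<^sub>R x)) at_top"
      by (rule filterlim_compose[OF lim])
        (rule filterlim_tendsto_pos_mult_at_top[OF tendsto_const c filterlim_ident])
    moreover have "((\<lambda>t. c * F x t) \<longlongrightarrow> c * p x) at_top"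
      by (intro tendsto_intros lim)
    ultimately show "p (c *\<^sub>R x) = c * p x"
      using tendsto_unique[OF trivial_limit_at_top_linorder] by simp
  next
    fix x :: 'a assume x: "0 \<le> x"
    have "p x \<le> f x"
      by (rule tendsto_upperbound[OF lim]) (simp_all add: F_le)
    moreover have "0 \<le> p x"
    proof (rule tendsto_lowerbound[OF lim])
      show "\<forall>\<^sub>F t in at_top. 0 \<le> F x t"
        using eventually_ge_at_top[of 0] by eventually_elim (rule F_nonneg[OF x])
    qed simp
    moreover have "f x \<le> norm f * norm x"
      using norm_blinfun[of f x] by simp
    ultimately show "\<bar>p x\<bar> \<le> norm f * norm x" by linarith
  qed
  then obtain g :: "'a \<Rightarrow>\<^sub>L real" where g: "\<And>x. 0 \<le> x \<Longrightarrow> g x = p x"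
    by blast
  show ?thesis
  proof (intro exI[of _ g] allI impI)
    fix x :: 'a assume "0 \<le> x"
    then show "((\<lambda>t. f (inf x (t *\<^sub>R v))) \<longlongrightarrow> g x) at_top"
      using lim[of x] g by (simp add: F_def[abs_def])
  qed
qed

lemma norm_abs_lattice: "norm \<bar>x\<bar> = norm x" for x :: "'a::banach_lattice"
  by (rule antisym) (rule norm_mono, simp)+

text \<open>Functionals carried by disjoint bands share out \<open>f\<close>: together they are dominated by \<open>f\<close>, because
  the truncations of \<open>x\<close> by disjoint elements are disjoint and lie below \<open>x\<close>. Hence
  \<open>x \<mapsto> (g n x)\<^sub>n\<close> is a bounded map into \<open>\<ell>\<^sup>1\<close>.\<close>

lemma ex_disjoint_band_functionals:
  fixes f :: "'a::banach_lattice \<Rightarrow>\<^sub>L real" and w :: "nat \<Rightarrow> 'a"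
  assumes f: "positive_functional f" and w: "\<And>n. 0 \<le> w n"
    and disj: "\<And>m n. m \<noteq> n \<Longrightarrow> inf (w m) (w n) = 0"
  obtains g :: "nat \<Rightarrow> 'a \<Rightarrow>\<^sub>L real"
  where "\<And>N x. (\<Sum>n<N. \<bar>g n x\<bar>) \<le> norm f * norm x"
    and "\<And>n x. w n \<le> x \<Longrightarrow> f (w n) \<le> g n x"
    and "\<And>n x. 0 \<le> x \<Longrightarrow> inf x (w n) = 0 \<Longrightarrow> g n x = 0"
proof -
  have "\<forall>n. \<exists>g :: 'a \<Rightarrow>\<^sub>L real. \<forall>x\<ge>0. ((\<lambda>t. f (inf x (t *\<^sub>R w n))) \<longlongrightarrow> g x) at_top"
    using ex_band_functional[OF f w] by blast
  from choice[OF this] obtain g :: "nat \<Rightarrow> 'a \<Rightarrow>\<^sub>L real"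
    where g: "\<And>n x. 0 \<le> x \<Longrightarrow> ((\<lambda>t. f (inf x (t *\<^sub>R w n))) \<longlongrightarrow> g n x) at_top"
    by blast
  have g_nonneg: "0 \<le> g n x" if x: "0 \<le> x" for n x
  proof (rule tendsto_lowerbound[OF g[OF x]])
    show "\<forall>\<^sub>F t in at_top. 0 \<le> f (inf x (t *\<^sub>R w n))"
      using eventually_ge_at_top[of 0]
      by eventually_elim (use f x w in \<open>simp add: positive_functional_def scaleR_nonneg_nonneg\<close>)
  qed simp
  have g_sum: "(\<Sum>n<N. g n x) \<le> f x" if x: "0 \<le> x" for N x
  proof (rule tendsto_upperbound)
    show "((\<lambda>t. \<Sum>n<N. f (inf x (t *\<^sub>R w n))) \<longlongrightarrow> (\<Sum>n<N. g n x)) at_top"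
      by (intro tendsto_sum g x)
    show "\<forall>\<^sub>F t in at_top. (\<Sum>n<N. f (inf x (t *\<^sub>R w n))) \<le> f x"
      using eventually_ge_at_top[of 0]
    proof eventually_elim
      case (elim t)
      have "(\<Sum>n<N. inf x (t *\<^sub>R w n)) \<le> x"
      proof (rule sum_disjoint_le)
        fix i j :: nat assume "i \<noteq> j"
        have "inf (w i) (t *\<^sub>R w j) = 0"
          by (rule disjoint_scaleR) (use elim w disj[OF \<open>i \<noteq> j\<close>] in auto)
        then have "inf (t *\<^sub>R w j) (t *\<^sub>R w i) = 0"
          by (intro disjoint_scaleR) (use elim w in \<open>auto simp: inf_commute scaleR_nonneg_nonneg\<close>)
        moreover have "inf (inf x (t *\<^sub>R w i)) (inf x (t *\<^sub>R w j)) \<le> inf (t *\<^sub>R w j) (t *\<^sub>R w i)"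
          by (simp add: le_infI1 le_infI2)
        moreover have "0 \<le> inf (inf x (t *\<^sub>R w i)) (inf x (t *\<^sub>R w j))"
          using x elim w by (simp add: scaleR_nonneg_nonneg)
        ultimately show "inf (inf x (t *\<^sub>R w i)) (inf x (t *\<^sub>R w j)) = 0"
          by (simp add: antisym)
      qed (use x elim w in \<open>auto simp: scaleR_nonneg_nonneg\<close>)
      from positive_functional_mono[OF f this] show ?case
        by (simp add: blinfun.sum_right)
    qed
  qed simp
  show thesis
  proof (rule that)
    fix N x
    have "\<bar>g n x\<bar> \<le> g n \<bar>x\<bar>" for n
    proof -
      have "x = pprt x - pprt (- x)"
        by (rule pprt_diff_pprt_uminus[symmetric])
      then have "g n x = g n (pprt x) - g n (pprt (- x))"
        by (metis blinfun.diff_right)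
      moreover have "g n \<bar>x\<bar> = g n (pprt x) + g n (pprt (- x))"
        by (simp add: abs_eq_pprt blinfun.add_right)
      ultimately show ?thesis
        using g_nonneg[of "pprt x" n] g_nonneg[of "pprt (- x)" n] by simp
    qed
    then have "(\<Sum>n<N. \<bar>g n x\<bar>) \<le> (\<Sum>n<N. g n \<bar>x\<bar>)"
      by (rule sum_mono)
    also have "\<dots> \<le> f \<bar>x\<bar>"
      by (rule g_sum) simp
    also have "\<dots> \<le> norm f * norm x"
      using norm_blinfun[of f "\<bar>x\<bar>"] by (simp add: norm_abs_lattice)
    finally show "(\<Sum>n<N. \<bar>g n x\<bar>) \<le> norm f * norm x" .
  next
    fix n x assume x: "w n \<le> x"
    then have "0 \<le> x" using w order_trans by blast
    show "f (w n) \<le> g n x"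
    proof (rule tendsto_lowerbound[OF g[OF \<open>0 \<le> x\<close>]])
      show "\<forall>\<^sub>F t in at_top. f (w n) \<le> f (inf x (t *\<^sub>R w n))"
        using eventually_ge_at_top[of 1]
      proof eventually_elim
        case (elim t)
        then have "1 *\<^sub>R w n \<le> t *\<^sub>R w n"
          by (intro scaleR_right_mono w)
        then show ?case
          using x by (intro positive_functional_mono[OF f]) simp
      qed
    qed simp
  next
    fix n x assume x: "0 \<le> x" "inf x (w n) = 0"
    have "\<forall>\<^sub>F t in at_top. f (inf x (t *\<^sub>R w n)) = 0"
      using eventually_ge_at_top[of 0]
      by eventually_elim (use x w in \<open>simp add: disjoint_scaleR\<close>)
    then have "((\<lambda>t. f (inf x (t *\<^sub>R w n))) \<longlongrightarrow> 0) at_top"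
      by (rule tendsto_eventually)
    with g[OF x(1)] show "g n x = 0"
      by (rule tendsto_unique[OF trivial_limit_at_top_linorder])
  qed
qed

section \<open>Weak compactness and sequences of functionals\<close>

text \<open>If no point were a cluster point, finitely many basic weak neighbourhoods that the net
  eventually avoids would cover the closure of \<open>A\<close>.\<close>

lemma weak_cluster_point:
  fixes a :: "'i \<Rightarrow> 'a::real_normed_vector"
  assumes A: "relatively_weakly_compact A" and \<F>: "\<F> \<noteq> bot" "\<forall>\<^sub>F n in \<F>. a n \<in> A"
  obtains y where "\<And>(H :: ('a \<Rightarrow>\<^sub>L real) set) e. finite H \<Longrightarrow> 0 < e \<Longrightarrow>
    \<exists>\<^sub>F n in \<F>. \<forall>h\<in>H. \<bar>blinfun_apply h (a n) - blinfun_apply h y\<bar> < e"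
proof -
  have open1: "openin weak_topology {z. \<bar>blinfun_apply h z - c\<bar> < e}" for h :: "'a \<Rightarrow>\<^sub>L real" and c e
  proof -
    have "{z. \<bar>blinfun_apply h z - c\<bar> < e} = blinfun_apply h -` ball c e"
      by (auto simp: dist_real_def abs_minus_commute)
    then show ?thesis
      unfolding weak_topology_def by (intro topology_generated_by_Basis) (use open_ball in blast)
  qed
  have UNIV: "openin weak_topology (UNIV :: 'a set)"
    using open1[of 0 0 1] by simp
  have openH: "openin weak_topology {z. \<forall>h\<in>H. \<bar>blinfun_apply h z - c h\<bar> < e}"
    if "finite H" for H :: "('a \<Rightarrow>\<^sub>L real) set" and c e
    using that
  proof (induction H rule: finite_induct)
    case (insert h H)
    have "{z. \<forall>h\<in>insert h H. \<bar>blinfun_apply h z - c h\<bar> < e} =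
        {z. \<bar>blinfun_apply h z - c h\<bar> < e} \<inter> {z. \<forall>h\<in>H. \<bar>blinfun_apply h z - c h\<bar> < e}"
      by auto
    then show ?case
      using insert open1 by (simp add: openin_Int)
  qed (simp add: UNIV)
  have "\<exists>y. \<forall>(H :: ('a \<Rightarrow>\<^sub>L real) set) e. finite H \<longrightarrow> 0 < e \<longrightarrow>
    (\<exists>\<^sub>F n in \<F>. \<forall>h\<in>H. \<bar>blinfun_apply h (a n) - blinfun_apply h y\<bar> < e)" (is "\<exists>y. ?cluster y")
  proof (rule ccontr)
    assume none: "\<nexists>y. ?cluster y"
    have "\<forall>y. \<exists>(H :: ('a \<Rightarrow>\<^sub>L real) set) e. finite H \<and> 0 < e \<and>
        (\<forall>\<^sub>F n in \<F>. \<not> (\<forall>h\<in>H. \<bar>blinfun_apply h (a n) - blinfun_apply h y\<bar> < e))"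
    proof
      fix y
      from none have "\<not> ?cluster y"
        by (rule contrapos_nn) (rule exI)
      then show "\<exists>(H :: ('a \<Rightarrow>\<^sub>L real) set) e. finite H \<and> 0 < e \<and>
          (\<forall>\<^sub>F n in \<F>. \<not> (\<forall>h\<in>H. \<bar>blinfun_apply h (a n) - blinfun_apply h y\<bar> < e))"
        by (simp only: not_all not_imp not_frequently)
    qed
    from choice[OF this] obtain H :: "'a \<Rightarrow> ('a \<Rightarrow>\<^sub>L real) set" where "\<forall>y. \<exists>e. finite (H y) \<and> 0 < e \<and>
        (\<forall>\<^sub>F n in \<F>. \<not> (\<forall>h\<in>H y. \<bar>blinfun_apply h (a n) - blinfun_apply h y\<bar> < e))"
      by (rule exE)
    from choice[OF this] obtain e :: "'a \<Rightarrow> real" where He: "\<forall>y. finite (H y) \<and> 0 < e y \<and>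
        (\<forall>\<^sub>F n in \<F>. \<not> (\<forall>h\<in>H y. \<bar>blinfun_apply h (a n) - blinfun_apply h y\<bar> < e y))"
      by (rule exE)
    from He have fin: "finite (H y)" and e: "0 < e y"
      and ev: "\<forall>\<^sub>F n in \<F>. \<not> (\<forall>h\<in>H y. \<bar>blinfun_apply h (a n) - blinfun_apply h y\<bar> < e y)" for y
      by simp_all
    define U where "U y = {z. \<forall>h\<in>H y. \<bar>blinfun_apply h z - blinfun_apply h y\<bar> < e y}" for y
    have "y \<in> U y" for y
      using e by (simp add: U_def)
    then have "weak_topology closure_of A \<subseteq> \<Union>(range U)"
      by blast
    moreover have "openin weak_topology V" if "V \<in> range U" for V
      using that openH[OF fin] by (auto simp: U_def)
    ultimately obtain \<V> where \<V>: "finite \<V>" "\<V> \<subseteq> range U" "weak_topology closure_of A \<subseteq> \<Union>\<V>"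
      using A compactinD unfolding relatively_weakly_compact_def by (metis (no_types, lifting))
    have "topspace weak_topology = (UNIV :: 'a set)"
      using openin_subset[OF UNIV] by auto
    then have "A \<subseteq> \<Union>\<V>"
      using \<V>(3) closure_of_subset[of A weak_topology] by auto
    have "\<forall>\<^sub>F n in \<F>. \<forall>V\<in>\<V>. a n \<notin> V"
    proof (rule eventually_ball_finite[OF \<V>(1)], rule ballI)
      fix V assume "V \<in> \<V>"
      then obtain y where "V = U y" using \<V>(2) by blast
      then show "\<forall>\<^sub>F n in \<F>. a n \<notin> V"
        using ev[of y] by (simp add: U_def)
    qed
    with \<F>(2) have "\<forall>\<^sub>F n in \<F>. False"
      by eventually_elim (use \<open>A \<subseteq> \<Union>\<V>\<close> in blast)
    with \<F>(1) show False
      by (simp add: eventually_False)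
  qed
  then show thesis
    using that by blast
qed

text \<open>The functionals form a bounded operator into \<open>\<ell>\<^sup>1\<close>, and by the Schur property of \<open>\<ell>\<^sup>1\<close> the image of
  \<open>A\<close> is relatively norm compact, so its tails are uniformly small. The proof runs Schur's gliding
  hump only as far as the diagonal requires, and uses weak cluster points in place of convergent
  subsequences. After a shift by a cluster point \<open>y\<close> of those \<open>a n\<close> with a large diagonal value, it
  selects indices \<open>u k\<close> along which the matrix \<open>g (u j) (a (u k) - y)\<close> is nearly diagonal. The sum \<open>h\<close> of
  the selected functionals then stays large on the selected points, although it vanishes at a weak
  cluster point of them.\<close>

lemma diagonal_functionals_tendsto_0:
  fixes g :: "nat \<Rightarrow> 'a::real_normed_vector \<Rightarrow>\<^sub>L real"
  assumes A: "relatively_weakly_compact A" and a: "\<And>n. a n \<in> A"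
    and sum_le: "\<And>x N. (\<Sum>n<N. \<bar>g n x\<bar>) \<le> C * norm x"
  shows "(\<lambda>n. g n (a n)) \<longlonglongrightarrow> 0"
proof (rule ccontr)
  assume "\<not> (\<lambda>n. g n (a n)) \<longlonglongrightarrow> 0"
  then obtain d where d: "d > 0" and often: "\<exists>\<^sub>F n in sequentially. d \<le> \<bar>g n (a n)\<bar>"
    by (auto simp: tendsto_iff not_eventually not_less)
  define \<F> where "\<F> = inf sequentially (principal {n. d \<le> \<bar>g n (a n)\<bar>})"
  have "\<F> \<noteq> bot"
    using often by (simp add: \<F>_def frequently_def eventually_inf_principal flip: eventually_False)
  have \<F>_seq: "\<forall>\<^sub>F n in \<F>. P n" if "\<forall>\<^sub>F n in sequentially. P n" for P
    using that by (auto simp: \<F>_def eventually_inf_principal elim: eventually_mono)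
  have \<F>_d: "\<forall>\<^sub>F n in \<F>. d \<le> \<bar>g n (a n)\<bar>"
    by (simp add: \<F>_def eventually_inf_principal)
  have sum_le_fin: "(\<Sum>n\<in>M. \<bar>g n x\<bar>) \<le> C * norm x" if M: "finite M" for M x
  proof -
    obtain N where "M \<subseteq> {..<N}"
      using finite_nat_iff_bounded[THEN iffD1, OF M] by blast
    then have "(\<Sum>n\<in>M. \<bar>g n x\<bar>) \<le> (\<Sum>n<N. \<bar>g n x\<bar>)"
      by (intro sum_mono2) auto
    with sum_le show ?thesis by (meson order_trans)
  qed
  have g_null: "(\<lambda>n. g n x) \<longlonglongrightarrow> 0" for x
  proof -
    have "summable (\<lambda>n. \<bar>g n x\<bar>)"
      by (rule summableI_nonneg_bounded[where x = "C * norm x"]) (use sum_le in auto)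
    then show ?thesis
      using summable_LIMSEQ_zero tendsto_rabs_zero_iff by blast
  qed
  obtain y where y: "\<And>(H :: ('a \<Rightarrow>\<^sub>L real) set) e. finite H \<Longrightarrow> 0 < e \<Longrightarrow>
      \<exists>\<^sub>F n in \<F>. \<forall>h\<in>H. \<bar>blinfun_apply h (a n) - blinfun_apply h y\<bar> < e"
    using weak_cluster_point[OF A \<open>\<F> \<noteq> bot\<close>, of a] a by auto
  define z where "z n = a n - y" for n
  \<comment> \<open>Entries with \<open>j < k\<close> can be made small as \<open>y\<close> is a cluster point; the entries where the
    functional has the larger index can, as \<open>g n x\<close> tends to \<open>0\<close> for each \<open>x\<close>. In each column
    either kind of entry adds up to at most \<open>d / 8\<close>.\<close>
  have "\<exists>u :: nat \<Rightarrow> nat. \<forall>k. (\<forall>j<k. u j < u k \<and> \<bar>g (u j) (z (u k))\<bar> < d / (8 * (real k + 1)) \<and>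
      \<bar>g (u k) (z (u j))\<bar> < d / 16 * (1/2) ^ k) \<and> d / 2 \<le> \<bar>g (u k) (z (u k))\<bar>"
  proof (rule dependent_wellorder_choice, goal_cases)
    case (2 k u)
    define H where "H = (\<lambda>j. g (u j)) ` {..<k}"
    have ev_all: "\<forall>\<^sub>F n in sequentially. \<forall>j<k. Q j n"
      if "\<And>j. \<forall>\<^sub>F n in sequentially. Q j n" for Q :: "nat \<Rightarrow> nat \<Rightarrow> bool"
      using eventually_ball_finite[of "{..<k}" "\<lambda>n j. Q j n" sequentially] that
      unfolding Ball_def lessThan_iff by blast
    have "\<exists>\<^sub>F n in \<F>. \<forall>h\<in>H. \<bar>blinfun_apply h (a n) - blinfun_apply h y\<bar> < d / (8 * (real k + 1))"
      by (rule y) (use d in \<open>auto simp: H_def\<close>)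
    moreover have "\<forall>\<^sub>F n in \<F>. \<forall>j<k. u j < n"
      by (intro \<F>_seq ev_all eventually_gt_at_top)
    moreover have "\<forall>\<^sub>F n in \<F>. \<forall>j<k. \<bar>g n (z (u j))\<bar> < d / 16 * (1/2) ^ k"
    proof (intro \<F>_seq ev_all)
      fix j
      show "\<forall>\<^sub>F n in sequentially. \<bar>g n (z (u j))\<bar> < d / 16 * (1/2) ^ k"
        using tendstoD[OF g_null, of "d / 16 * (1/2) ^ k" "z (u j)"] d by simp
    qed
    moreover have "\<forall>\<^sub>F n in \<F>. \<bar>g n y\<bar> < d / 2"
      using \<F>_seq[OF tendstoD[OF g_null, of "d / 2" y]] d by simp
    ultimately have "\<exists>\<^sub>F n in \<F>. ((\<forall>j<k. u j < n) \<and> (\<forall>j<k. \<bar>g n (z (u j))\<bar> < d / 16 * (1/2) ^ k)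
        \<and> \<bar>g n y\<bar> < d / 2 \<and> d \<le> \<bar>g n (a n)\<bar>)
        \<and> (\<forall>h\<in>H. \<bar>blinfun_apply h (a n) - blinfun_apply h y\<bar> < d / (8 * (real k + 1)))"
      using \<F>_d by (intro frequently_eventually_conj eventually_conj)
    then obtain n where n: "\<forall>h\<in>H. \<bar>blinfun_apply h (a n) - blinfun_apply h y\<bar> < d / (8 * (real k + 1))"
        "\<forall>j<k. u j < n" "\<forall>j<k. \<bar>g n (z (u j))\<bar> < d / 16 * (1/2) ^ k"
        "\<bar>g n y\<bar> < d / 2" "d \<le> \<bar>g n (a n)\<bar>"
      using frequently_ex by blast
    have "d / 2 \<le> \<bar>g n (z n)\<bar>"
      using n(4,5) unfolding z_def blinfun.diff_right by linarith
    with n(1-3) show ?case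
      by (intro exI[of _ n]) (auto simp: H_def z_def blinfun.diff_right)
  qed auto
  then obtain u where u_less: "\<And>j k. j < k \<Longrightarrow> u j < u k"
    and u_low: "\<And>j k. j < k \<Longrightarrow> \<bar>g (u j) (z (u k))\<bar> < d / (8 * (real k + 1))"
    and u_high: "\<And>j k. j < k \<Longrightarrow> \<bar>g (u k) (z (u j))\<bar> < d / 16 * (1/2) ^ k"
    and u_diag: "\<And>k. d / 2 \<le> \<bar>g (u k) (z (u k))\<bar>"
    by auto
  have "inj u"
    by (rule strict_mono_imp_inj_on) (simp add: strict_mono_def u_less)
  have sum_u: "(\<Sum>j<N. \<bar>g (u j) x\<bar>) \<le> C * norm x" for N x
    using sum_le_fin[of "u ` {..<N}" x] inj_on_subset[OF \<open>inj u\<close> subset_UNIV, of "{..<N}"]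
    by (simp add: sum.reindex)
  have summ: "summable (\<lambda>j. \<bar>g (u j) x\<bar>)" for x
    by (rule summableI_nonneg_bounded[where x = "C * norm x"]) (use sum_u in auto)
  have summ': "summable (\<lambda>j. g (u j) x)" for x
    by (rule summable_rabs_cancel[OF summ])
  have "bounded_linear (\<lambda>x. \<Sum>j. g (u j) x)"
  proof (rule bounded_linear_intro)
    fix x show "norm (\<Sum>j. g (u j) x) \<le> norm x * C"
      using summable_rabs[OF summ, of x] suminf_le_const[OF summ sum_u, of x]
      by (simp add: mult.commute)
  qed (simp_all add: blinfun.add_right blinfun.scaleR_right suminf_add suminf_mult summ')
  then obtain h :: "'a \<Rightarrow>\<^sub>L real" where h: "\<And>x. h x = (\<Sum>j. g (u j) x)"
    by (metis bounded_linear_Blinfun_apply)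
  have h_lower: "d / 4 \<le> \<bar>h (z (u k))\<bar>" for k
  proof -
    have "(\<lambda>N. \<bar>\<Sum>j<N. g (u j) (z (u k))\<bar>) \<longlonglongrightarrow> \<bar>h (z (u k))\<bar>"
      unfolding h by (intro tendsto_rabs summable_LIMSEQ summ')
    then show ?thesis
    proof (rule tendsto_lowerbound)
      show "\<forall>\<^sub>F N in sequentially. d / 4 \<le> \<bar>\<Sum>j<N. g (u j) (z (u k))\<bar>"
        using eventually_gt_at_top[of k]
      proof eventually_elim
        case (elim N)
        let ?G = "\<lambda>j. g (u j) (z (u k))"
        have disj: "{..<k} \<inter> {k<..<N} = {}"
          by auto
        have "(\<Sum>j<N. ?G j) = sum ?G (insert k ({..<k} \<union> {k<..<N}))"
          using elim by (intro arg_cong[where f = "sum ?G"]) auto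
        also have "\<dots> = ?G k + sum ?G ({..<k} \<union> {k<..<N})"
          by (rule sum.insert) auto
        also have "sum ?G ({..<k} \<union> {k<..<N}) = (\<Sum>j<k. ?G j) + (\<Sum>j\<in>{k<..<N}. ?G j)"
          by (rule sum.union_disjoint) (use disj in auto)
        finally have "(\<Sum>j<N. ?G j) = ?G k + ((\<Sum>j<k. ?G j) + (\<Sum>j\<in>{k<..<N}. ?G j))" .
        moreover have "\<bar>\<Sum>j<k. ?G j\<bar> \<le> d / 8"
        proof -
          have "\<bar>\<Sum>j<k. ?G j\<bar> \<le> (\<Sum>j<k. d / (8 * (real k + 1)))"
            by (rule order_trans[OF sum_abs sum_mono]) (rule less_imp_le[OF u_low], simp)
          also have "\<dots> = d / 8 * (real k / (real k + 1))"
            by simp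
          also have "\<dots> \<le> d / 8 * 1"
            by (rule mult_left_mono) (use d in auto)
          also have "\<dots> = d / 8"
            by simp
          finally show ?thesis .
        qed
        moreover have "\<bar>\<Sum>j\<in>{k<..<N}. ?G j\<bar> \<le> d / 8"
        proof -
          have "\<bar>\<Sum>j\<in>{k<..<N}. ?G j\<bar> \<le> (\<Sum>j\<in>{k<..<N}. d / 16 * (1/2) ^ j)"
            by (rule order_trans[OF sum_abs sum_mono]) (rule less_imp_le[OF u_high], simp)
          also have "\<dots> \<le> (\<Sum>j<N. d / 16 * (1/2) ^ j)"
            by (rule sum_mono2) (use d in auto)
          also have "\<dots> = d / 16 * (\<Sum>j<N. (1/2) ^ j)"
            by (simp add: sum_distrib_left)
          also have "\<dots> \<le> d / 16 * 2"
            using d by (intro mult_left_mono) (simp_all add: sum_gp_strict)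
          finally show ?thesis by simp
        qed
        ultimately show ?case
          using u_diag[of k] by linarith
      qed
    qed simp
  qed
  \<comment> \<open>The selected points have a weak cluster point \<open>y'\<close> of their own, possibly different from \<open>y\<close>,
    but no selected functional separates the two.\<close>
  obtain y' where y': "\<And>(H :: ('a \<Rightarrow>\<^sub>L real) set) e. finite H \<Longrightarrow> 0 < e \<Longrightarrow>
      \<exists>\<^sub>F k in sequentially. \<forall>h\<in>H. \<bar>blinfun_apply h (a (u k)) - blinfun_apply h y'\<bar> < e"
    using weak_cluster_point[OF A sequentially_bot, of "\<lambda>k. a (u k)"] a by auto
  have "g (u j) (y' - y) = 0" for j
  proof (rule ccontr)
    assume nz: "g (u j) (y' - y) \<noteq> 0"
    define e where "e = \<bar>g (u j) (y' - y)\<bar> / 2"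
    have e: "e > 0" using nz by (simp add: e_def)
    have "(\<lambda>k. d / (8 * (real k + 1))) \<longlonglongrightarrow> 0"
      by real_asymp
    then have "\<forall>\<^sub>F k in sequentially. d / (8 * (real k + 1)) < e"
      using e d by (auto dest: order_tendstoD)
    moreover have "\<forall>\<^sub>F k in sequentially. j < k"
      by (rule eventually_gt_at_top)
    ultimately have "\<forall>\<^sub>F k in sequentially. \<bar>g (u j) (z (u k))\<bar> < e"
      by eventually_elim (use u_low in \<open>fastforce simp: add.commute intro: less_trans\<close>)
    moreover have "\<exists>\<^sub>F k in sequentially. \<forall>h\<in>{g (u j)}. \<bar>blinfun_apply h (a (u k)) - blinfun_apply h y'\<bar> < e"
      by (rule y') (simp_all add: e)
    ultimately have "\<exists>\<^sub>F k in sequentially. \<bar>g (u j) (z (u k))\<bar> < e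
        \<and> (\<forall>h\<in>{g (u j)}. \<bar>blinfun_apply h (a (u k)) - blinfun_apply h y'\<bar> < e)"
      by (intro frequently_eventually_conj)
    then obtain k where "\<bar>g (u j) (a (u k)) - g (u j) y'\<bar> < e" "\<bar>g (u j) (z (u k))\<bar> < e"
      using frequently_ex by fastforce
    moreover have "\<bar>q - r\<bar> \<le> \<bar>p - q\<bar> + \<bar>p - r\<bar>" for p q r :: real
      by linarith
    from this[of "g (u j) y'" "g (u j) y" "g (u j) (a (u k))"]
    have "2 * e \<le> \<bar>g (u j) (a (u k)) - g (u j) y'\<bar> + \<bar>g (u j) (z (u k))\<bar>"
      by (simp add: e_def z_def blinfun.diff_right)
    ultimately show False
      by linarith
  qed
  then have "h y' = h y"
    by (simp add: h blinfun.diff_right)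
  have "\<exists>\<^sub>F k in sequentially. \<forall>h\<in>{h}. \<bar>blinfun_apply h (a (u k)) - blinfun_apply h y'\<bar> < d / 4"
    by (rule y') (use d in auto)
  then obtain k where "\<bar>h (a (u k)) - h y'\<bar> < d / 4"
    using frequently_ex by fastforce
  with h_lower[of k] \<open>h y' = h y\<close> show False
    by (simp add: z_def blinfun.diff_right)
qed

section \<open>From unbounded order convergence to almost disjoint sequences\<close>

text \<open>The positive cone is norm closed, as a negative part of the limit would be dominated by the
  distance to the positive approximants.\<close>

lemma nonneg_limit:
  fixes X :: "'i \<Rightarrow> 'a::banach_lattice"
  assumes lim: "(X \<longlongrightarrow> L) F" and F: "F \<noteq> bot" and nonneg: "\<forall>\<^sub>F i in F. 0 \<le> X i"
  shows "0 \<le> L"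
proof -
  have "\<forall>\<^sub>F i in F. norm (pprt (- L)) \<le> norm (X i - L)"
    using nonneg
  proof eventually_elim
    case (elim i)
    have "pprt (- L) \<le> \<bar>X i - L\<bar>"
      unfolding pprt_def using elim abs_ge_self[of "X i - L"]
      by (auto intro: order_trans[of _ "X i - L"])
    then show ?case
      by (intro norm_mono) simp
  qed
  moreover have "((\<lambda>i. norm (X i - L)) \<longlongrightarrow> 0) F"
    using tendsto_norm_zero[OF LIM_zero[OF lim]] .
  ultimately have "norm (pprt (- L)) \<le> 0"
    using tendsto_lowerbound F by blast
  then have "- L \<le> 0"
    by (simp add: le_zero_iff_zero_pprt)
  then show ?thesis by simp
qed

lemma term_le_suminf:
  fixes t :: "nat \<Rightarrow> 'a::banach_lattice"
  assumes "summable t" "\<And>n. 0 \<le> t n"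
  shows "t m \<le> suminf t"
proof -
  have "0 \<le> suminf t - t m"
  proof (rule nonneg_limit)
    show "(\<lambda>N. (\<Sum>n<N. t n) - t m) \<longlonglongrightarrow> suminf t - t m"
      by (intro tendsto_intros summable_LIMSEQ assms)
    show "\<forall>\<^sub>F N in sequentially. 0 \<le> (\<Sum>n<N. t n) - t m"
      using eventually_gt_at_top[of m]
    proof eventually_elim
      case (elim N)
      then have "(\<Sum>n\<in>{m}. t n) \<le> (\<Sum>n<N. t n)"
        by (intro sum_mono2) (use assms in auto)
      then show ?case by simp
    qed
  qed simp
  then show ?thesis by simp
qed

text \<open>If \<open>f \<bar>a n - l\<bar>\<close> were at least \<open>e\<close> for all \<open>n\<close>, subtracting \<open>W\<close> from the
  larger signed part of each \<open>a n - l\<close> would leave disjoint positive elements on which \<open>f\<close> is still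
  at least \<open>e / 4\<close>. The functionals on their bands form a sequence dominated by \<open>f\<close> with
  diagonal values of modulus at least \<open>e / 4\<close>, against weak compactness.\<close>

lemma almost_disjoint_functional_small:
  fixes f :: "'a::banach_lattice \<Rightarrow>\<^sub>L real" and a :: "nat \<Rightarrow> 'a"
  assumes A: "relatively_weakly_compact A" and a: "\<And>n. a n \<in> A"
    and f: "positive_functional f" and e: "0 < e"
    and W: "\<And>m n. m \<noteq> n \<Longrightarrow> inf \<bar>a m - l\<bar> \<bar>a n - l\<bar> \<le> W" and fW: "f W \<le> e / 4"
  shows "\<exists>n. f \<bar>a n - l\<bar> < e"
proof (rule ccontr)
  assume "\<nexists>n. f \<bar>a n - l\<bar> < e"
  then have large: "e \<le> f \<bar>a n - l\<bar>" for n
    by (simp add: not_less)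
  \<comment> \<open>Keeping only the larger of the two signed parts of \<open>a n - l\<close> prevents cancellation: the band
    functional of the remainder does not see the other part.\<close>
  have "\<forall>n. \<exists>s. (s = a n - l \<or> s = - (a n - l)) \<and> e / 2 \<le> f (pprt s)"
  proof
    fix n
    have "f \<bar>a n - l\<bar> = f (pprt (a n - l)) + f (pprt (- (a n - l)))"
      by (simp only: abs_eq_pprt blinfun.add_right)
    with large[of n] have "e / 2 \<le> f (pprt (a n - l)) \<or> e / 2 \<le> f (pprt (- (a n - l)))"
      by linarith
    then show "\<exists>s. (s = a n - l \<or> s = - (a n - l)) \<and> e / 2 \<le> f (pprt s)"
      by blast
  qed
  from choice[OF this] obtain s where s_eq: "\<And>n. s n = a n - l \<or> s n = - (a n - l)"
    and s_large: "\<And>n. e / 2 \<le> f (pprt (s n))"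
    by blast
  have "0 \<le> inf \<bar>a 0 - l\<bar> \<bar>a 1 - l\<bar>" by simp
  with W[of 0 1] have W0: "0 \<le> W"
    by (meson order_trans zero_neq_one)
  define w where "w n = pprt (pprt (s n) - W)" for n
  have w_le: "w n \<le> pprt (s n)" for n
    unfolding w_def pprt_def[of "pprt (s n) - W"] using W0 by (simp add: diff_le_eq add_increasing2)
  have s_le: "pprt (s n) \<le> \<bar>a n - l\<bar>" for n
    using s_eq[of n] abs_ge_self[of "s n"] by (auto simp: pprt_def abs_minus_commute simp del: abs_ge_self)
  have w_nonneg: "0 \<le> w n" for n
    by (simp add: w_def)
  have w_disj: "inf (w m) (w n) = 0" if "m \<noteq> n" for m n
    unfolding w_def
  proof (rule inf_excess_eq_0)
    show "inf (pprt (s m)) (pprt (s n)) \<le> W"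
      using order_trans[OF inf_mono[OF s_le s_le] W[OF that]] .
  qed
  obtain g :: "nat \<Rightarrow> 'a \<Rightarrow>\<^sub>L real"
    where g_sum: "\<And>N x. (\<Sum>n<N. \<bar>g n x\<bar>) \<le> norm f * norm x"
      and g_ge: "\<And>n x. w n \<le> x \<Longrightarrow> f (w n) \<le> g n x"
      and g_0: "\<And>n x. 0 \<le> x \<Longrightarrow> inf x (w n) = 0 \<Longrightarrow> g n x = 0"
    by (rule ex_disjoint_band_functionals[OF f, of w])
      (rule w_nonneg, rule w_disj, assumption, rule that, assumption+)
  have g_large: "e / 4 \<le> \<bar>g n (a n - l)\<bar>" for n
  proof -
    have "pprt (s n) - W \<le> w n"
      by (simp add: w_def pprt_def)
    from positive_functional_mono[OF f this] have "e / 4 \<le> f (w n)"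
      using s_large[of n] fW by (simp add: blinfun.diff_right)
    also have "\<dots> \<le> g n (pprt (s n))"
      by (rule g_ge[OF w_le])
    also have "\<dots> = g n (s n)"
    proof -
      have "inf (pprt (- s n)) (w n) \<le> inf (pprt (s n)) (pprt (- s n))"
        using w_le[of n] by (auto intro: le_infI2)
      then have "g n (pprt (- s n)) = 0"
        by (intro g_0) (simp_all add: inf_pprt_pprt_uminus antisym w_def)
      moreover have "s n = pprt (s n) - pprt (- s n)"
        by (rule pprt_diff_pprt_uminus[symmetric])
      ultimately show ?thesis
        by (metis blinfun.diff_right diff_zero)
    qed
    finally have "e / 4 \<le> g n (s n)" .
    moreover have "\<bar>g n (s n)\<bar> = \<bar>g n (a n - l)\<bar>"
      using s_eq[of n] by (elim disjE) (simp_all only: blinfun.minus_right abs_minus_cancel)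
    ultimately show ?thesis
      by linarith
  qed
  have "(\<lambda>n. g n (a n)) \<longlonglongrightarrow> 0"
    by (rule diagonal_functionals_tendsto_0[OF A a g_sum])
  moreover have "(\<lambda>n. g n l) \<longlonglongrightarrow> 0"
  proof -
    have "summable (\<lambda>n. \<bar>g n l\<bar>)"
      by (rule summableI_nonneg_bounded[where x = "norm f * norm l"]) (use g_sum in auto)
    then show ?thesis
      using summable_LIMSEQ_zero tendsto_rabs_zero_iff by blast
  qed
  ultimately have "(\<lambda>n. g n (a n - l)) \<longlonglongrightarrow> 0"
    using tendsto_diff by (fastforce simp: blinfun.diff_right)
  then have "\<forall>\<^sub>F n in sequentially. \<bar>g n (a n - l)\<bar> < e / 4"
    using tendstoD[of _ 0 sequentially "e / 4"] e by fastforce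
  then show False
    using g_large by (auto simp: eventually_sequentially not_le[symmetric])
qed

text \<open>Each new index is taken so far along the filter that the new element has a tiny meet, in norm,
  with the sum of the moduli of all earlier ones. These meets then form a norm convergent series,
  whose sum \<open>W\<close> dominates every pairwise meet.\<close>

lemma frequently_large_imp_almost_disjoint:
  fixes x :: "'i \<Rightarrow> 'a::banach_lattice"
  assumes often: "\<exists>\<^sub>F i in F. P i" and d: "0 < d"
    and null: "\<And>s. 0 \<le> s \<Longrightarrow> ((\<lambda>i. inf \<bar>x i\<bar> s) \<longlongrightarrow> 0) F"
  shows "\<exists>(i :: nat \<Rightarrow> 'i) W. (\<forall>n. P (i n)) \<and> norm W \<le> d \<and>
    (\<forall>m n. m \<noteq> n \<longrightarrow> inf \<bar>x (i m)\<bar> \<bar>x (i n)\<bar> \<le> W)"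
proof -
  have "\<exists>i. \<forall>n. P (i n) \<and> norm (inf \<bar>x (i n)\<bar> (\<Sum>k<n. \<bar>x (i k)\<bar>)) < d / 2 * (1/2) ^ n"
  proof (rule dependent_wellorder_choice, goal_cases)
    case (2 n i)
    have "\<forall>\<^sub>F r in F. norm (inf \<bar>x r\<bar> (\<Sum>k<n. \<bar>x (i k)\<bar>)) < d / 2 * (1/2) ^ n"
      using tendstoD[OF null, of "\<Sum>k<n. \<bar>x (i k)\<bar>" "d / 2 * (1/2) ^ n"] d
      by (simp add: sum_nonneg)
    from frequently_eventually_conj[OF often this] show ?case
      using frequently_ex by fastforce
  qed simp
  then obtain i where P: "\<And>n. P (i n)"
    and small: "\<And>n. norm (inf \<bar>x (i n)\<bar> (\<Sum>k<n. \<bar>x (i k)\<bar>)) < d / 2 * (1/2) ^ n"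
    by blast
  define t where "t n = inf \<bar>x (i n)\<bar> (\<Sum>k<n. \<bar>x (i k)\<bar>)" for n
  have t_nonneg: "0 \<le> t n" for n
    by (simp add: t_def sum_nonneg)
  have t_small: "norm (t n) \<le> d / 2 * (1/2) ^ n" for n
    using small[of n] by (simp add: t_def)
  have geo: "(\<lambda>n. d / 2 * (1/2) ^ n) sums (d / 2 * 2)"
    using sums_mult[OF geometric_sums[of "1/2 :: real"], of "d / 2"] by simp
  have summ_norm: "summable (\<lambda>n. norm (t n))"
    by (rule summable_comparison_test[OF _ sums_summable[OF geo]]) (use t_small in auto)
  have "norm (suminf t) \<le> (\<Sum>n. norm (t n))"
    by (rule summable_norm[OF summ_norm])
  also have "\<dots> \<le> (\<Sum>n. d / 2 * (1/2) ^ n)"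
    by (rule suminf_le[OF t_small summ_norm sums_summable[OF geo]])
  also have "\<dots> = d"
    using sums_unique[OF geo] by simp
  finally have "norm (suminf t) \<le> d" .
  moreover have less: "inf \<bar>x (i m)\<bar> \<bar>x (i n)\<bar> \<le> suminf t" if "m < n" for m n
  proof -
    have "(\<Sum>k\<in>{m}. \<bar>x (i k)\<bar>) \<le> (\<Sum>k<n. \<bar>x (i k)\<bar>)"
      by (rule sum_mono2) (use that in auto)
    then have "inf \<bar>x (i m)\<bar> \<bar>x (i n)\<bar> \<le> t n"
      unfolding t_def by (simp add: le_infI1)
    also have "\<dots> \<le> suminf t"
      by (rule term_le_suminf[OF summable_norm_cancel[OF summ_norm] t_nonneg])
    finally show ?thesis .
  qed
  moreover have "inf \<bar>x (i m)\<bar> \<bar>x (i n)\<bar> \<le> suminf t" if "m \<noteq> n" for m n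
    using less[of m n] less[of n m] that by (auto simp: inf_commute neq_iff)
  ultimately show ?thesis
    using P by blast
qed

text \<open>The subbasic sets are balls around arbitrary centres \<open>c\<close>, so the triangle inequality is needed to
  reach a subbasic neighbourhood of \<open>l\<close>.\<close>

lemma limitin_absolute_weak_topologyI:
  fixes x :: "'i \<Rightarrow> 'a::banach_lattice"
  assumes lim: "\<And>f. positive_functional f \<Longrightarrow> ((\<lambda>a. blinfun_apply f \<bar>x a - l\<bar>) \<longlongrightarrow> 0) F"
  shows "limitin absolute_weak_topology x l F"
  unfolding limitin_def
proof (intro conjI allI impI)
  let ?B = "{{y :: 'a. blinfun_apply f \<bar>y - c\<bar> < e} | f c e. positive_functional f \<and> e > 0}"
  have "UNIV \<in> ?B"
    by (rule CollectI, rule exI[of _ 0], rule exI[of _ 0], rule exI[of _ 1])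
      (simp add: positive_functional_def)
  then show "l \<in> topspace absolute_weak_topology"
    unfolding absolute_weak_topology_def topology_generated_by_topspace by blast
  fix U assume U: "openin absolute_weak_topology U \<and> l \<in> U"
  then have "generate_topology_on ?B U"
    by (simp add: absolute_weak_topology_def openin_topology_generated_by_iff)
  then have "l \<in> U \<longrightarrow> (\<forall>\<^sub>F a in F. x a \<in> U)"
  proof induction
    case (Int U V)
    then show ?case by (auto intro: eventually_conj)
  next
    case (UN K)
    show ?case
    proof
      assume "l \<in> \<Union>K"
      then obtain V where V: "V \<in> K" "l \<in> V" by blast
      with UN have "\<forall>\<^sub>F a in F. x a \<in> V" by blast
      then show "\<forall>\<^sub>F a in F. x a \<in> \<Union>K"
        by (rule eventually_mono) (use V in blast)
    qed
  next
    case (Basis U)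
    then obtain f c e where U: "U = {y. blinfun_apply f \<bar>y - c\<bar> < e}" and f: "positive_functional f"
      by blast
    show ?case
    proof
      assume "l \<in> U"
      then have "0 < e - f \<bar>l - c\<bar>" by (simp add: U)
      from order_tendstoD(2)[OF lim[OF f] this] have "\<forall>\<^sub>F a in F. f \<bar>x a - l\<bar> < e - f \<bar>l - c\<bar>" .
      then show "\<forall>\<^sub>F a in F. x a \<in> U"
      proof eventually_elim
        case (elim a)
        have "\<bar>x a - c\<bar> \<le> \<bar>x a - l\<bar> + \<bar>l - c\<bar>"
          using abs_triangle_ineq[of "x a - l" "l - c"] by simp
        from positive_functional_mono[OF f this] elim show ?case
          by (simp add: U blinfun.add_right)
      qed
    qed
  qed simp
  with U show "\<forall>\<^sub>F a in F. x a \<in> U" by blast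
qed

theorem proposition3p9:
  fixes I :: "'i set" and le :: "'i \<Rightarrow> 'i \<Rightarrow> bool"
    and x :: "'i \<Rightarrow> 'a::order_continuous_banach_lattice" and l :: 'a
  assumes "directed_set I le"
    and "relatively_weakly_compact (x ` I)"
    and "uo_converges I le x l"
  shows "limitin absolute_weak_topology x l (net_filter I le) \<and>
    (\<forall>f. positive_functional f \<longrightarrow>
      ((\<lambda>a. blinfun_apply f \<bar>x a - l\<bar>) \<longlongrightarrow> 0) (net_filter I le))"
proof -
  let ?F = "net_filter I le"
  have null: "((\<lambda>a. inf \<bar>x a - l\<bar> s) \<longlongrightarrow> 0) ?F" if "0 \<le> s" for s
    using assms(3) that by (intro order_null_imp_norm_null[OF assms(1)]) (simp add: uo_converges_def)
  have "\<exists>a. a \<in> I"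
    using assms(1) unfolding directed_set_def by blast
  then have in_I: "\<forall>\<^sub>F a in ?F. a \<in> I"
    unfolding eventually_net_filter[OF assms(1)] by blast
  have lim: "((\<lambda>a. f \<bar>x a - l\<bar>) \<longlongrightarrow> 0) ?F" if f: "positive_functional f" for f
  proof (rule tendstoI, rule ccontr)
    fix e :: real assume e: "0 < e" and "\<not> (\<forall>\<^sub>F a in ?F. dist (f \<bar>x a - l\<bar>) 0 < e)"
    moreover have "0 \<le> f \<bar>x a - l\<bar>" for a
      using f by (simp add: positive_functional_def)
    ultimately have "\<exists>\<^sub>F a in ?F. e \<le> f \<bar>x a - l\<bar>"
      by (simp add: not_eventually not_less)
    then have often: "\<exists>\<^sub>F a in ?F. a \<in> I \<and> e \<le> f \<bar>x a - l\<bar>"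
      using in_I by (rule frequently_eventually_conj)
    \<comment> \<open>This bound on \<open>norm W\<close> makes \<open>f W \<le> e / 4\<close>; adding \<open>1\<close> covers \<open>f = 0\<close>.\<close>
    define d where "d = e / (4 * (norm f + 1))"
    have "0 < 4 * (norm f + 1)"
      by (simp add: add_nonneg_pos)
    then have "0 < d"
      using e by (simp add: d_def)
    have "\<exists>(i :: nat \<Rightarrow> 'i) W. (\<forall>n. i n \<in> I \<and> e \<le> f \<bar>x (i n) - l\<bar>) \<and> norm W \<le> d \<and>
        (\<forall>m n. m \<noteq> n \<longrightarrow> inf \<bar>x (i m) - l\<bar> \<bar>x (i n) - l\<bar> \<le> W)"
      by (rule frequently_large_imp_almost_disjoint[OF often \<open>0 < d\<close>]) (rule null)
    then obtain i :: "nat \<Rightarrow> 'i" and W where i: "\<And>n. i n \<in> I \<and> e \<le> f \<bar>x (i n) - l\<bar>" and W: "norm W \<le> d"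
      and disj: "\<And>m n. m \<noteq> n \<Longrightarrow> inf \<bar>x (i m) - l\<bar> \<bar>x (i n) - l\<bar> \<le> W"
      by blast
    have "f W \<le> norm f * norm W"
      using norm_blinfun[of f W] by simp
    also have "\<dots> \<le> (norm f + 1) * d"
      by (rule mult_mono) (use W \<open>0 < d\<close> in auto)
    also have "\<dots> = e / 4"
      using \<open>0 < 4 * (norm f + 1)\<close> by (simp add: d_def field_simps)
    finally have "\<exists>n. f \<bar>x (i n) - l\<bar> < e"
      by (intro almost_disjoint_functional_small[OF assms(2) _ f e disj]) (use i in auto)
    with i show False
      by (meson not_le)
  qed
  then show ?thesis
    by (simp add: limitin_absolute_weak_topologyI)
qed

end
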